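(* Let $\mathcal{T}$ be a junction tree for a Bayesian network over a finite set $V$ of discrete variables with probability function $p$. Let $a$ be a value of a variable $A\in V$, let $e$ be the available evidence, and let $x=p(b\mid\pi)$ be a parameter of the network, where $b$ is a value of a variable $B\in V$ and $\pi$ is a combination of values of the parents $\Pi=\mathrm{pa}(B)$, with initially specified value $p(b\mid\pi)<1$. Suppose that, in $\mathcal{T}$, an inward propagation (with evidence $e$) has been performed towards a clique containing the variable $B$. Let $x^1,x^2\in[0,1]$ be two distinct values of $x$, and for $k\in\{1,2\}$ let $$y_a^k=p(a,e)(x^k),\qquad y_{\neg a}^k=p(\neg a,e)(x^k)$$ be the probabilities obtained, by marginalization of the potential of a clique $H$ of $\mathcal{T}$ containing $A$, from the outward propagation with the value $x^k$ for $x$. For $s\in\{a,\neg a\}$ put $$\alpha_s=\frac{y_s^1-y_s^2}{x^1-x^2},\qquad \beta_s=\frac{x^1y_s^2-x^2y_s^1}{x^1-x^2}.$$ Then, as a function of $x\in[0,1]$, $p(e)(x)=\gamma x+\delta$ with $$\gamma=\alpha_a+\alpha_{\neg a}\qquad\text{and}\qquad \delta=\beta_a+\beta_{\neg a}.$$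
   Context: A Bayesian network over a finite set $V$ of variables with finite domains consists of a directed acyclic graph on $V$ and, for each $X\in V$ and each combination of values of its parents $\mathrm{pa}(X)$, a conditional probability distribution on $\mathrm{dom}(X)$ whose entries are the parameters of the network. It defines the joint probability function $p(V)=\prod_{X\in V}p(X\mid \mathrm{pa}(X))$. Evidence $e$ is an assignment of values to some subset of the variables; $\neg a$ denotes the event $A\neq a$. Co-variation convention: the parameter $p(b\mid\pi)$ is varied to an arbitrary value $x\in[0,1]$, and the other parameters of the same conditional distribution are scaled proportionally: for $b'\in\mathrm{dom}(B)$, $$p(b'\mid\pi)(x)=\begin{cases}x & b'=b,\\ p(b'\mid\pi)\,\dfrac{1-x}{1-p(b\mid\pi)} & b'\ne b,\end{cases}$$ where $p(b\mid\pi)<1$. All other parameters stay fixed. Symbols $p(\cdot\mid\cdot)$ without an argument $x$ denote the initially specified values. For an event $E$, $p(E)(x)$ denotes the probability of $E$ under the network with the varied parameters; e.g. $p(a,e)(x)$ and $p(\neg a,e)(x)$ are the resulting probabilities of "$A=a$ and $e$" and "$A\ne a$ and $e$". Potentials: after an outward propagation with the value $x^k$ for $x$, the potential of a clique $H\subseteq V$ is the table assigning to each configuration $h$ of $H$ the probability of the joint event "$H=h$ and $e$" in the network in which $x$ has the value $x^k$ (with co-variation). *)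

theory Defs
  imports Complex_Main "HOL-Library.FuncSet"
begin

section \<open>Bayesian networks\<close>

text \<open>
  A configuration of a set \<open>W\<close> of variables is an extensional function in
  \<open>PiE W (vals N)\<close>. The parameter \<open>cpt N X \<pi> c\<close> is $p(X = c \mid \mathrm{pa}(X) = \pi)$; it is
  meaningful only for a variable \<open>X\<close> of the network, a configuration \<open>\<pi>\<close> of its parents and
  a value \<open>c\<close> of \<open>X\<close>.
\<close>

record ('v, 'd) bayes_net =
  vars :: "'v set"
  vals :: "'v \<Rightarrow> 'd set"
  pa :: "'v \<Rightarrow> 'v set"
  cpt :: "'v \<Rightarrow> ('v \<Rightarrow> 'd) \<Rightarrow> 'd \<Rightarrow> real"

definition configs :: "('v, 'd) bayes_net \<Rightarrow> 'v set \<Rightarrow> ('v \<Rightarrow> 'd) set" where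
  "configs N W = PiE W (vals N)"

definition arcs :: "('v, 'd) bayes_net \<Rightarrow> ('v \<times> 'v) set" where
  "arcs N = {(X, Y). Y \<in> vars N \<and> X \<in> pa N Y}"

locale bayesian_network =
  fixes N :: "('v, 'd) bayes_net"
  assumes finite_vars: "finite (vars N)"
    and finite_vals: "X \<in> vars N \<Longrightarrow> finite (vals N X)"
    and pa_subset: "X \<in> vars N \<Longrightarrow> pa N X \<subseteq> vars N"
    and acyclic_arcs: "acyclic (arcs N)"
    and cpt_nonneg:
      "X \<in> vars N \<Longrightarrow> \<pi> \<in> configs N (pa N X) \<Longrightarrow> c \<in> vals N X \<Longrightarrow> 0 \<le> cpt N X \<pi> c"
    and cpt_sum:
      "X \<in> vars N \<Longrightarrow> \<pi> \<in> configs N (pa N X) \<Longrightarrow> (\<Sum>c\<in>vals N X. cpt N X \<pi> c) = 1"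

definition joint :: "('v, 'd) bayes_net \<Rightarrow> ('v \<Rightarrow> 'd) \<Rightarrow> real" where
  "joint N v = (\<Prod>X\<in>vars N. cpt N X (restrict v (pa N X)) (v X))"

definition prob :: "('v, 'd) bayes_net \<Rightarrow> ('v \<Rightarrow> 'd) set \<Rightarrow> real" where
  "prob N E = (\<Sum>v\<in>configs N (vars N) \<inter> E. joint N v)"

definition val_event :: "'v \<Rightarrow> 'd \<Rightarrow> ('v \<Rightarrow> 'd) set" where
  "val_event X c = {v. v X = c}"

definition is_evidence :: "('v, 'd) bayes_net \<Rightarrow> ('v \<rightharpoonup> 'd) \<Rightarrow> bool" where
  "is_evidence N e \<longleftrightarrow> dom e \<subseteq> vars N \<and> (\<forall>X c. e X = Some c \<longrightarrow> c \<in> vals N X)"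

definition evidence_event :: "('v \<rightharpoonup> 'd) \<Rightarrow> ('v \<Rightarrow> 'd) set" where
  "evidence_event e = {v. \<forall>X c. e X = Some c \<longrightarrow> v X = c}"

text \<open>
  The network in which the parameter $p(b \mid \pi)$ of the variable \<open>B\<close> has the value \<open>x\<close>, the other
  parameters of the same conditional distribution being co-varied proportionally.
\<close>

definition vary ::
  "('v, 'd) bayes_net \<Rightarrow> 'v \<Rightarrow> ('v \<Rightarrow> 'd) \<Rightarrow> 'd \<Rightarrow> real \<Rightarrow> ('v, 'd) bayes_net" where
  "vary N B \<pi> b x = N\<lparr>cpt := (cpt N)(B := (cpt N B)(\<pi> :=
     (\<lambda>b'. if b' = b then x else cpt N B \<pi> b' * ((1 - x) / (1 - cpt N B \<pi> b)))))\<rparr>"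


section \<open>Junction trees\<close>

text \<open>An undirected graph is given by its vertex set and a symmetric irreflexive edge relation.\<close>

definition ugraph :: "'a set \<Rightarrow> ('a \<times> 'a) set \<Rightarrow> bool" where
  "ugraph W G \<longleftrightarrow> G \<subseteq> W \<times> W \<and> sym G \<and> irrefl G"

definition simple_path :: "('a \<times> 'a) set \<Rightarrow> 'a list \<Rightarrow> bool" where
  "simple_path G xs \<longleftrightarrow> xs \<noteq> [] \<and> distinct xs \<and> successively (\<lambda>u w. (u, w) \<in> G) xs"

definition cycle :: "('a \<times> 'a) set \<Rightarrow> 'a list \<Rightarrow> bool" where
  "cycle G xs \<longleftrightarrow> simple_path G xs \<and> length xs \<ge> 3 \<and> (last xs, hd xs) \<in> G"

definition tree :: "'a set \<Rightarrow> ('a \<times> 'a) set \<Rightarrow> bool" where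
  "tree W G \<longleftrightarrow> ugraph W G \<and> W \<noteq> {} \<and> (\<forall>u\<in>W. \<forall>w\<in>W. (u, w) \<in> G\<^sup>*) \<and> (\<nexists>xs. cycle G xs)"

definition chordal :: "('a \<times> 'a) set \<Rightarrow> bool" where
  "chordal G \<longleftrightarrow> (\<forall>xs. cycle G xs \<and> length xs \<ge> 4 \<longrightarrow>
     (\<exists>i j. i + 1 < j \<and> j < length xs \<and> \<not> (i = 0 \<and> j = length xs - 1) \<and> (xs ! i, xs ! j) \<in> G))"

definition complete_set :: "'a set \<Rightarrow> ('a \<times> 'a) set \<Rightarrow> 'a set \<Rightarrow> bool" where
  "complete_set W G C \<longleftrightarrow> C \<subseteq> W \<and> (\<forall>u\<in>C. \<forall>w\<in>C. u \<noteq> w \<longrightarrow> (u, w) \<in> G)"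

definition cliques :: "'a set \<Rightarrow> ('a \<times> 'a) set \<Rightarrow> 'a set set" where
  "cliques W G = {C. complete_set W G C \<and> (\<forall>C'. complete_set W G C' \<and> C \<subseteq> C' \<longrightarrow> C' = C)}"

definition moral_graph :: "('v, 'd) bayes_net \<Rightarrow> ('v \<times> 'v) set" where
  "moral_graph N = {(X, Y). X \<in> vars N \<and> Y \<in> vars N \<and> X \<noteq> Y \<and>
     ((X, Y) \<in> arcs N \<or> (Y, X) \<in> arcs N \<or> (\<exists>Z. (X, Z) \<in> arcs N \<and> (Y, Z) \<in> arcs N))}"

text \<open>
  \<open>\<K>\<close> is the set of nodes and \<open>T\<close> the edge relation of the tree: the nodes are the cliques of a
  triangulation \<open>G\<close> of the moral graph, and the intersection of two nodes is contained in every
  node on the path between them.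
\<close>

definition junction_tree ::
  "('v, 'd) bayes_net \<Rightarrow> 'v set set \<Rightarrow> ('v set \<times> 'v set) set \<Rightarrow> bool" where
  "junction_tree N \<K> T \<longleftrightarrow>
     (\<exists>G. ugraph (vars N) G \<and> moral_graph N \<subseteq> G \<and> chordal G \<and> \<K> = cliques (vars N) G) \<and>
     tree \<K> T \<and>
     (\<forall>Cs. set Cs \<subseteq> \<K> \<and> simple_path T Cs \<longrightarrow> (\<forall>C\<in>set Cs. hd Cs \<inter> last Cs \<subseteq> C))"

text \<open>
  The potential of the clique \<open>H\<close> after inward propagation with evidence \<open>e\<close> and outward
  propagation in the network \<open>N\<close> is the table of the probabilities of ``$H = h$ and $e$''.
\<close>

definition potential ::
  "('v, 'd) bayes_net \<Rightarrow> ('v \<rightharpoonup> 'd) \<Rightarrow> 'v set \<Rightarrow> ('v \<Rightarrow> 'd) \<Rightarrow> real" where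
  "potential N e H h = prob N ({v. restrict v H = h} \<inter> evidence_event e)"

definition marginal ::
  "('v, 'd) bayes_net \<Rightarrow> 'v set \<Rightarrow> (('v \<Rightarrow> 'd) \<Rightarrow> real) \<Rightarrow> ('v \<Rightarrow> 'd) set \<Rightarrow> real" where
  "marginal N H \<phi> S = (\<Sum>h\<in>configs N H \<inter> S. \<phi> h)"

end

theory Submission
  imports Defs
begin

text \<open>
  Varying a parameter changes a single conditional distribution, each entry of which becomes affine
  in the parameter. The joint probability of a configuration contains exactly one factor for \<open>B\<close>,
  so the probability of every event is affine in the parameter and is determined by its values at
  two points. Marginalizing the potential of a clique containing \<open>A\<close> gives these values for
  ``$a$ and $e$'' and ``$\neg a$ and $e$'', whose probabilities add up to that of $e$.
\<close>

lemma vars_vary [simp]: "vars (vary N B \<pi> b x) = vars N"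
  and pa_vary [simp]: "pa (vary N B \<pi> b x) = pa N"
  by (simp_all add: vary_def)

lemma configs_vary [simp]: "configs (vary N B \<pi> b x) W = configs N W"
  by (simp add: configs_def vary_def)

lemma (in bayesian_network) finite_configs:
  "W \<subseteq> vars N \<Longrightarrow> finite (configs N W)"
  unfolding configs_def using finite_vars finite_vals
  by (intro finite_PiE) (auto intro: finite_subset)

lemma prob_Un_disjoint:
  assumes "finite (configs N (vars N))" "E \<inter> F = {}"
  shows "prob N (E \<union> F) = prob N E + prob N F"
  unfolding prob_def Int_Un_distrib using assms by (intro sum.union_disjoint) auto

text \<open>Group the configurations of all variables by their restriction to \<open>H\<close>: each
  fibre contributes one entry of the potential. The hypothesis on \<open>S\<close> says that
  \<open>S\<close> is decided by the coordinates in \<open>H\<close>, so a fibre lies entirely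
  inside \<open>S\<close> or entirely outside it.\<close>

lemma marginal_potential:
  assumes fin: "finite (configs M (vars M))" "finite (configs M H)"
    and H: "H \<subseteq> vars M"
    and S: "\<And>v. restrict v H \<in> S \<longleftrightarrow> v \<in> S"
  shows "marginal M H (potential M e H) S = prob M (S \<inter> evidence_event e)"
proof -
  let ?r = "\<lambda>v. restrict v H"
  let ?D = "configs M (vars M) \<inter> (S \<inter> evidence_event e)"
  have "?r ` ?D \<subseteq> configs M H \<inter> S"
    using H by (auto simp: S configs_def)
  then have "prob M (S \<inter> evidence_event e) =
      (\<Sum>h\<in>configs M H \<inter> S. \<Sum>v | v \<in> ?D \<and> ?r v = h. joint M v)"
    unfolding prob_def using fin by (intro sum.group[symmetric]) auto
  also have "\<dots> = marginal M H (potential M e H) S"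
  proof -
    have "{v \<in> ?D. ?r v = h} = configs M (vars M) \<inter> ({v. ?r v = h} \<inter> evidence_event e)"
      if "h \<in> S" for h using that S by blast
    then show ?thesis
      unfolding marginal_def potential_def prob_def by (intro sum.cong refl) auto
  qed
  finally show ?thesis ..
qed

lemma joint_vary_affine:
  assumes "finite (vars N)" "B \<in> vars N"
  shows "\<exists>p q. \<forall>x. joint (vary N B \<pi> b x) v = p * x + q"
proof -
  \<comment> \<open>\<open>K\<close> collects the factors that the variation leaves alone, so it is
    constant in \<open>x\<close>.\<close>
  define K where "K = (\<Prod>X\<in>vars N - {B}. cpt N X (restrict v (pa N X)) (v X))"
  let ?\<rho> = "restrict v (pa N B)"
  have joint: "joint (vary N B \<pi> b x) v = cpt (vary N B \<pi> b x) B ?\<rho> (v B) * K" for x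
    unfolding joint_def K_def using assms
    by (simp add: prod.remove[of _ B]) (auto simp: vary_def intro!: prod.cong)
  have "\<exists>p q. \<forall>x. cpt (vary N B \<pi> b x) B ?\<rho> (v B) = p * x + q"
  proof (cases "?\<rho> = \<pi>")
    \<comment> \<open>Here \<open>v\<close> selects another parent configuration, whose distribution
      is not varied.\<close>
    case False
    then show ?thesis
      by (intro exI[of _ 0] exI[of _ "cpt N B ?\<rho> (v B)"]) (simp add: vary_def)
  next
    case \<rho>: True
    show ?thesis
    proof (cases "v B = b")
      case True
      then show ?thesis using \<rho>
        by (intro exI[of _ 1] exI[of _ 0]) (simp add: vary_def)
    next
      case False
      \<comment> \<open>Proportional scaling turns this entry into \<open>c * (1 - x)\<close>. If
        the denominator is 0, both expressions are 0, as division by 0 yields 0.\<close>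
      define c where "c = cpt N B \<pi> (v B) / (1 - cpt N B \<pi> b)"
      show ?thesis using \<rho> False
        by (intro exI[of _ "- c"] exI[of _ c]) (simp add: vary_def c_def algebra_simps diff_divide_distrib)
    qed
  qed
  then obtain p q where "cpt (vary N B \<pi> b x) B ?\<rho> (v B) = p * x + q" for x by blast
  then have "joint (vary N B \<pi> b x) v = (p * K) * x + q * K" for x
    by (simp add: joint algebra_simps)
  then show ?thesis by blast
qed

lemma prob_vary_affine:
  assumes "finite (vars N)" "B \<in> vars N"
  shows "\<exists>p q. \<forall>x. prob (vary N B \<pi> b x) E = p * x + q"
proof -
  \<comment> \<open>The coefficients are chosen as functions of \<open>v\<close>. They can then be
    summed over the event, since the set of configurations does not change with
    \<open>x\<close>.\<close>
  obtain p q where "joint (vary N B \<pi> b x) v = p v * x + q v" for v x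
    using joint_vary_affine[OF assms] by metis
  then have "prob (vary N B \<pi> b x) E =
      sum p (configs N (vars N) \<inter> E) * x + sum q (configs N (vars N) \<inter> E)" for x
    by (simp add: prob_def sum.distrib sum_distrib_right)
  then show ?thesis by blast
qed

lemma affine_interpolation:
  fixes f :: "'a::field \<Rightarrow> 'a"
  assumes "\<exists>p q. \<forall>x. f x = p * x + q" "s \<noteq> t"
  shows "f x = (f s - f t) / (s - t) * x + (s * f t - t * f s) / (s - t)"
proof -
  obtain p q where f: "f x = p * x + q" for x using assms(1) by blast
  \<comment> \<open>The first combination eliminates \<open>q\<close>, the second eliminates
    \<open>p\<close>; dividing by \<open>s - t\<close> recovers the slope and the intercept.\<close>
  have "f s - f t = p * (s - t)" "s * f t - t * f s = q * (s - t)"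
    by (simp_all add: f algebra_simps)
  then show ?thesis using \<open>s \<noteq> t\<close> by (simp add: f)
qed

theorem theorem5:
  fixes N :: "('v, 'd) bayes_net"
    and \<K> :: "'v set set" and T :: "('v set \<times> 'v set) set" and R H :: "'v set"
    and A B :: 'v and a b :: 'd and \<pi> :: "'v \<Rightarrow> 'd" and e :: "'v \<rightharpoonup> 'd"
    and x1 x2 ya1 ya2 yna1 yna2 \<alpha>a \<alpha>na \<beta>a \<beta>na \<gamma> \<delta> :: real
  assumes "bayesian_network N"
    and "junction_tree N \<K> T"
    and "A \<in> vars N" and "a \<in> vals N A"
    and "is_evidence N e"
    and "B \<in> vars N" and "b \<in> vals N B" and "\<pi> \<in> configs N (pa N B)"
    and "cpt N B \<pi> b < 1"
    and "R \<in> \<K>" and "B \<in> R"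
    and "H \<in> \<K>" and "A \<in> H"
    and "x1 \<in> {0..1}" and "x2 \<in> {0..1}" and "x1 \<noteq> x2"
    and "ya1 = marginal N H (potential (vary N B \<pi> b x1) e H) (val_event A a)"
    and "ya2 = marginal N H (potential (vary N B \<pi> b x2) e H) (val_event A a)"
    and "yna1 = marginal N H (potential (vary N B \<pi> b x1) e H) (- val_event A a)"
    and "yna2 = marginal N H (potential (vary N B \<pi> b x2) e H) (- val_event A a)"
    and "\<alpha>a = (ya1 - ya2) / (x1 - x2)"
    and "\<alpha>na = (yna1 - yna2) / (x1 - x2)"
    and "\<beta>a = (x1 * ya2 - x2 * ya1) / (x1 - x2)"
    and "\<beta>na = (x1 * yna2 - x2 * yna1) / (x1 - x2)"
    and "\<gamma> = \<alpha>a + \<alpha>na"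
    and "\<delta> = \<beta>a + \<beta>na"
  shows "ya1 = prob (vary N B \<pi> b x1) (val_event A a \<inter> evidence_event e) \<and>
         ya2 = prob (vary N B \<pi> b x2) (val_event A a \<inter> evidence_event e) \<and>
         yna1 = prob (vary N B \<pi> b x1) (- val_event A a \<inter> evidence_event e) \<and>
         yna2 = prob (vary N B \<pi> b x2) (- val_event A a \<inter> evidence_event e) \<and>
         (\<forall>x\<in>{0..1}. prob (vary N B \<pi> b x) (evidence_event e) = \<gamma> * x + \<delta>)"
proof -
  interpret bayesian_network N by fact
  let ?M = "vary N B \<pi> b"
  let ?E = "evidence_event e"
  have H: "H \<subseteq> vars N"
    using \<open>junction_tree N \<K> T\<close> \<open>H \<in> \<K>\<close>
    by (auto simp: junction_tree_def cliques_def complete_set_def)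
  \<comment> \<open>The marginal is taken in \<open>N\<close> but the potential in the varied
    network; both have the same configurations of \<open>H\<close>.\<close>
  have marg: "marginal N H (potential (?M x) e H) S = prob (?M x) (S \<inter> ?E)"
    if "\<And>v. restrict v H \<in> S \<longleftrightarrow> v \<in> S" for S x
    using marginal_potential[of "?M x" H S e] that H finite_configs by (simp add: marginal_def)
  \<comment> \<open>Since \<open>A \<in> H\<close>, restricting to \<open>H\<close> keeps the value
    of \<open>A\<close>, so the event and its complement are both decided on
    \<open>H\<close>.\<close>
  have y: "ya1 = prob (?M x1) (val_event A a \<inter> ?E)" "ya2 = prob (?M x2) (val_event A a \<inter> ?E)"
    "yna1 = prob (?M x1) (- val_event A a \<inter> ?E)" "yna2 = prob (?M x2) (- val_event A a \<inter> ?E)"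
    using assms(17-20) \<open>A \<in> H\<close> by (simp_all add: marg val_event_def)
  have affine: "prob (?M x) F = (prob (?M x1) F - prob (?M x2) F) / (x1 - x2) * x +
      (x1 * prob (?M x2) F - x2 * prob (?M x1) F) / (x1 - x2)" for x F
    using prob_vary_affine[OF finite_vars \<open>B \<in> vars N\<close>] \<open>x1 \<noteq> x2\<close> by (rule affine_interpolation)
  have "prob (?M x) ?E = \<gamma> * x + \<delta>" for x
  proof -
    have "prob (?M x) ?E = prob (?M x) ((val_event A a \<inter> ?E) \<union> (- val_event A a \<inter> ?E))"
      by (rule arg_cong[of _ _ "prob (?M x)"]) blast
    also have "\<dots> = prob (?M x) (val_event A a \<inter> ?E) + prob (?M x) (- val_event A a \<inter> ?E)"
      by (rule prob_Un_disjoint) (auto simp: finite_configs)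
    also have "\<dots> = (\<alpha>a * x + \<beta>a) + (\<alpha>na * x + \<beta>na)"
      \<comment> \<open>Reading \<open>y\<close> from right to left turns the interpolation
        coefficients into the given \<alpha> and \<beta>.\<close>
      using affine[of x "val_event A a \<inter> ?E"] affine[of x "- val_event A a \<inter> ?E"] assms(21-24)
      by (simp flip: y)
    finally show ?thesis
      using assms(25,26) by (simp add: algebra_simps)
  qed
  with y show ?thesis by blast
qed

end
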